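(* Let $\varepsilon^0>0$, $\delta^0>0$ and $\sigma\in(0,1)$, and let $\{x^n\}_{n\in\mathbb{N}}$ be a sequence of iterates generated by the exact penalty (EXP) algorithm described in the context with these parameters. Then every accumulation point $x^*$ of $\{x^n\}_{n\in\mathbb{N}}$ is a global minimizer of the problem $\min_{x\in W}\tilde J(x)$.
   Context: Setting: $N,l,S\in\mathbb{N}$ with $S\le l$; $M\in\mathbb{R}^{N\times N}$ is symmetric positive definite (finite element mass matrix); $K\in\mathbb{R}^{N\times N}$ is positive definite, i.e. $v^{\top}Kv>0$ for $v\neq 0$, not necessarily symmetric (finite element stiffness matrix); $\Phi\in\mathbb{R}^{N\times l}$ (finite element coefficients of the source functions in its columns); $y_d\in\mathbb{R}^N$ (desired state). Points $x\in\mathbb{R}^{N+l}$ are written $x=(y,u)^{\top}$ with $y\in\mathbb{R}^N$ (state) and $u\in\mathbb{R}^l$ (control). Define $f:\mathbb{R}^l\to\mathbb{R}^N$, $f(u)=K^{-1}M\Phi u$, and $$W=\Big\{(y,u)^{\top}\in\mathbb{R}^{N+l}\ \Big|\ u\in\{0,1\}^l,\ \sum_{i=1}^l u_i\le S,\ y=f(u)\Big\},$$ $$X=\Big\{(y,u)^{\top}\in\mathbb{R}^{N+l}\ \Big|\ u\in[0,1]^l,\ \sum_{i=1}^l u_i\le S,\ y=f(u)\Big\}.$$ The objective is $\tilde J(x)=\frac12(y-y_d)^{\top}M(y-y_d)$ and, for $\varepsilon>0$, the penalized objective is $$J(x;\varepsilon)=\frac12(y-y_d)^{\top}M(y-y_d)+\frac1\varepsilon\sum_{i=1}^l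 u_i(1-u_i).$$ Smart rounding: for $x=(y,u)^{\top}\in X$, the vector $[u]_{SR}\in\{0,1\}^l$ is obtained by rounding the $S$ largest components of $u$ component-wise to the closest integer and setting the remaining components to $0$; then $[x]_{SR}:=(f([u]_{SR}),[u]_{SR})^{\top}\in W$. EXP algorithm with parameters $\varepsilon^0>0$, $\delta^0>0$, $\sigma\in(0,1)$: for $n=0,1,2,\dots$ do the following. Step 1: compute some $x^n\in X$ such that $J(x^n;\varepsilon^n)\le J(x;\varepsilon^n)+\delta^n$ for all $x\in X$. Step 2: if $x^n\notin W$ and $J(x^n;\varepsilon^n)-J([x^n]_{SR};\varepsilon^n)\le\varepsilon^n\|x^n-[x^n]_{SR}\|_2$, set $\varepsilon^{n+1}=\sigma\varepsilon^n$ and $\delta^{n+1}=\delta^n$; otherwise set $\varepsilon^{n+1}=\varepsilon^n$ and $\delta^{n+1}=\sigma\delta^n$. Step 3: replace $n$ by $n+1$ and return to Step 1 (the algorithm does not terminate, so it produces an infinite sequence). *)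

theory Defs
  imports "HOL-Analysis.Analysis"
begin

text \<open>
  The dimensions are \<open>N = CARD('n)\<close> and \<open>l = CARD('l)\<close>.  The space of points
  \<open>x = (y, u)\<close> is the product type, whose norm is the Euclidean norm of the
  concatenated vector.
\<close>

definition pos_def_mat :: "real^'n^'n \<Rightarrow> bool" where
  "pos_def_mat A \<longleftrightarrow> (\<forall>v. v \<noteq> 0 \<longrightarrow> v \<bullet> (A *v v) > 0)"

definition state_map :: "real^'n^'n \<Rightarrow> real^'n^'n \<Rightarrow> real^'l^'n \<Rightarrow> real^'l \<Rightarrow> real^'n" where
  "state_map K M \<Phi> u = (matrix_inv K ** M ** \<Phi>) *v u"

definition W_set :: "real^'n^'n \<Rightarrow> real^'n^'n \<Rightarrow> real^'l^'n \<Rightarrow> nat \<Rightarrow> ((real^'n) \<times> (real^'l)) set" where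
  "W_set K M \<Phi> S =
    {(y, u). (\<forall>i. u $ i \<in> {0, 1}) \<and> (\<Sum>i\<in>UNIV. u $ i) \<le> real S \<and> y = state_map K M \<Phi> u}"

definition X_set :: "real^'n^'n \<Rightarrow> real^'n^'n \<Rightarrow> real^'l^'n \<Rightarrow> nat \<Rightarrow> ((real^'n) \<times> (real^'l)) set" where
  "X_set K M \<Phi> S =
    {(y, u). (\<forall>i. u $ i \<in> {0..1}) \<and> (\<Sum>i\<in>UNIV. u $ i) \<le> real S \<and> y = state_map K M \<Phi> u}"

definition J_tilde :: "real^'n^'n \<Rightarrow> real^'n \<Rightarrow> (real^'n) \<times> (real^'l) \<Rightarrow> real" where
  "J_tilde M yd x = 1/2 * ((fst x - yd) \<bullet> (M *v (fst x - yd)))"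

definition J_pen :: "real^'n^'n \<Rightarrow> real^'n \<Rightarrow> real \<Rightarrow> (real^'n) \<times> (real^'l) \<Rightarrow> real" where
  "J_pen M yd \<epsilon> x =
    1/2 * ((fst x - yd) \<bullet> (M *v (fst x - yd))) +
    1/\<epsilon> * (\<Sum>i\<in>UNIV. snd x $ i * (1 - snd x $ i))"

definition closest_integer :: "real \<Rightarrow> real \<Rightarrow> bool" where
  "closest_integer t r \<longleftrightarrow> r \<in> \<int> \<and> (\<forall>k\<in>\<int>. \<bar>t - r\<bar> \<le> \<bar>t - k\<bar>)"

text \<open>
  Neither the set \<open>I\<close> of the \<open>S\<close> largest components (if components coincide) nor the
  closest integer (for components equal to \<open>1/2\<close>) is unique.  Hence smart rounding is
  a relation, and a smart rounding map is any function that resolves these ties.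
\<close>

definition is_smart_rounding :: "nat \<Rightarrow> real^'l \<Rightarrow> real^'l \<Rightarrow> bool" where
  "is_smart_rounding S u v \<longleftrightarrow>
    (\<exists>I. card I = S \<and> (\<forall>i\<in>I. \<forall>j\<in>-I. u $ j \<le> u $ i) \<and>
      (\<forall>i\<in>I. closest_integer (u $ i) (v $ i)) \<and> (\<forall>i\<in>-I. v $ i = 0))"

definition smart_rounding_map :: "nat \<Rightarrow> (real^'l \<Rightarrow> real^'l) \<Rightarrow> bool" where
  "smart_rounding_map S sr \<longleftrightarrow>
    (\<forall>u. (\<forall>i. u $ i \<in> {0..1}) \<and> (\<Sum>i\<in>UNIV. u $ i) \<le> real S \<longrightarrow> is_smart_rounding S u (sr u))"

definition smart_round_point :: "real^'n^'n \<Rightarrow> real^'n^'n \<Rightarrow> real^'l^'n \<Rightarrow> (real^'l \<Rightarrow> real^'l)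
    \<Rightarrow> (real^'n) \<times> (real^'l) \<Rightarrow> (real^'n) \<times> (real^'l)" where
  "smart_round_point K M \<Phi> sr x = (state_map K M \<Phi> (sr (snd x)), sr (snd x))"

text \<open>
  The iterate in Step 1 is any \<open>\<delta> n\<close>-approximate minimizer, so a run of the algorithm is
  described by a predicate on sequences rather than by a recursive function.
\<close>

definition EXP_sequence :: "real^'n^'n \<Rightarrow> real^'n^'n \<Rightarrow> real^'l^'n \<Rightarrow> real^'n \<Rightarrow> nat
    \<Rightarrow> (real^'l \<Rightarrow> real^'l) \<Rightarrow> real \<Rightarrow> real \<Rightarrow> real \<Rightarrow> (nat \<Rightarrow> (real^'n) \<times> (real^'l)) \<Rightarrow> bool" where
  "EXP_sequence K M \<Phi> yd S sr \<epsilon>0 \<delta>0 \<sigma> x \<longleftrightarrow>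
    (\<exists>\<epsilon> \<delta> :: nat \<Rightarrow> real. \<epsilon> 0 = \<epsilon>0 \<and> \<delta> 0 = \<delta>0 \<and>
      (\<forall>n. x n \<in> X_set K M \<Phi> S \<and>
        (\<forall>z\<in>X_set K M \<Phi> S. J_pen M yd (\<epsilon> n) (x n) \<le> J_pen M yd (\<epsilon> n) z + \<delta> n) \<and>
        (if x n \<notin> W_set K M \<Phi> S \<and>
            J_pen M yd (\<epsilon> n) (x n) - J_pen M yd (\<epsilon> n) (smart_round_point K M \<Phi> sr (x n))
              \<le> \<epsilon> n * norm (x n - smart_round_point K M \<Phi> sr (x n))
         then \<epsilon> (Suc n) = \<sigma> * \<epsilon> n \<and> \<delta> (Suc n) = \<delta> n
         else \<epsilon> (Suc n) = \<epsilon> n \<and> \<delta> (Suc n) = \<sigma> * \<delta> n)))"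

definition accumulation_point :: "(nat \<Rightarrow> 'a::topological_space) \<Rightarrow> 'a \<Rightarrow> bool" where
  "accumulation_point x a \<longleftrightarrow> (\<exists>r :: nat \<Rightarrow> nat. strict_mono r \<and> (x \<circ> r) \<longlonglongrightarrow> a)"

end

theory Submission
  imports Defs
begin

text \<open>
  The heart of the matter is that the penalty parameter \<open>\<epsilon>\<close> is reduced only finitely often.
  For small \<open>\<epsilon>\<close>, an approximate minimizer of the penalized objective has a small penalty
  \<open>\<Sum>i. u $ i * (1 - u $ i)\<close>, so that its control is almost binary
  (\<open>penalty_le_of_approx_min\<close>).  The cardinality budget then leaves room for at most \<open>S\<close> entries
  near \<open>1\<close>, and smart rounding coincides with rounding every entry to its closest integer
  (\<open>smart_rounding_error_le_half\<close>).  In that regime the penalty dominates half of the rounding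
  error, whereas \<open>J_tilde\<close> changes at most proportionally to it (\<open>J_tilde_lipschitz_on_X\<close>).  With the factor \<open>1 / \<epsilon>\<close>, rounding
  decreases the penalized objective by more than \<open>\<epsilon>\<close> times the distance moved
  (\<open>rounding_gain_gt\<close>): the test that triggers a reduction of \<open>\<epsilon>\<close> must fail.

  Hence \<open>\<epsilon>\<close> is eventually constant and \<open>\<delta>\<close> tends to \<open>0\<close> geometrically.  From then on each
  iterate lies in \<open>W\<close>, or rounding it gains more than \<open>\<epsilon>\<close> times the distance moved; as no point
  of \<open>X\<close> can improve on the iterate by more than \<open>\<delta>\<close>, the iterate is within \<open>\<delta> / \<epsilon>\<close> of \<open>W\<close>.
  An accumulation point is therefore in the closed set \<open>W\<close>.  Approximate minimality passes to the
  limit, and on \<open>W\<close> the penalty vanishes, which gives minimality for \<open>J_tilde\<close>.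
\<close>

section \<open>Smart rounding\<close>

lemma closest_integer_unit_interval:
  assumes "0 \<le> t" "t \<le> 1" "closest_integer t r"
  shows "r \<in> {0, 1}" and "\<bar>t - r\<bar> \<le> 1/2"
proof -
  have r: "r \<in> \<int>" "\<bar>t - r\<bar> \<le> \<bar>t - 0\<bar>" "\<bar>t - r\<bar> \<le> \<bar>t - 1\<bar>"
    using assms(3) Ints_0 Ints_1 unfolding closest_integer_def by blast+
  show half: "\<bar>t - r\<bar> \<le> 1/2" using r(2,3) assms(1,2) by linarith
  obtain k :: int where k: "r = of_int k" using r(1) by (auto elim: Ints_cases)
  have "-1 < real_of_int k" "real_of_int k < 2" using half assms(1,2) k by linarith+
  then have "k = 0 \<or> k = 1" by linarith
  then show "r \<in> {0, 1}" using k by auto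
qed

lemma smart_rounding_feasible:
  fixes u v :: "real^'l"
  assumes box: "\<forall>i. u $ i \<in> {0..1}" and sr: "is_smart_rounding S u v"
  shows "\<forall>i. v $ i \<in> {0, 1}" and "(\<Sum>i\<in>UNIV. v $ i) \<le> real S"
proof -
  obtain I where I: "card I = S" "\<forall>i\<in>I. closest_integer (u $ i) (v $ i)" "\<forall>i\<in>-I. v $ i = 0"
    using sr unfolding is_smart_rounding_def by blast
  show bin: "\<forall>i. v $ i \<in> {0, 1}"
  proof
    fix i
    show "v $ i \<in> {0, 1}"
    proof (cases "i \<in> I")
      case True
      then show ?thesis using I(2) box closest_integer_unit_interval(1)[of "u $ i" "v $ i"] by auto
    next
      case False
      then show ?thesis using I(3) by auto
    qed
  qed
  have "(\<Sum>i\<in>UNIV. v $ i) = (\<Sum>i\<in>I. v $ i)"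
    by (rule sum.mono_neutral_right) (use I(3) in auto)
  also have "\<dots> \<le> (\<Sum>i\<in>I. 1)"
  proof (rule sum_mono)
    show "v $ i \<le> 1" for i using spec[OF bin, of i] by auto
  qed
  finally show "(\<Sum>i\<in>UNIV. v $ i) \<le> real S" using I(1) by simp
qed

text \<open>
  The danger is an entry above \<open>1/2\<close> outside the \<open>S\<close> largest ones, which smart rounding sends to
  \<open>0\<close>.  Then \<open>S + 1\<close> entries exceed \<open>1/2\<close>; the penalty bound pushes each of them up to
  \<open>1 - 1 / (2 * (S + 1))\<close>, and their sum is at least \<open>S + 1/2\<close>, against the budget \<open>S\<close>.
\<close>

lemma smart_rounding_error_le_half:
  fixes u v :: "real^'l"
  assumes box: "\<forall>i. u $ i \<in> {0..1}" and budget: "(\<Sum>i\<in>UNIV. u $ i) \<le> real S"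
    and sr: "is_smart_rounding S u v"
    and pen: "(\<Sum>i\<in>UNIV. u $ i * (1 - u $ i)) \<le> 1 / (4 * (real S + 1))"
  shows "\<bar>u $ i - v $ i\<bar> \<le> 1/2"
proof -
  obtain I where I: "card I = S" "\<forall>i\<in>I. \<forall>j\<in>-I. u $ j \<le> u $ i"
      "\<forall>i\<in>I. closest_integer (u $ i) (v $ i)" "\<forall>i\<in>-I. v $ i = 0"
    using sr unfolding is_smart_rounding_def by blast
  have near_one: "1 - 1 / (2 * (real S + 1)) \<le> u $ j" if "1/2 < u $ j" for j
  proof -
    have "u $ j * (1 - u $ j) \<le> (\<Sum>i\<in>UNIV. u $ i * (1 - u $ i))"
      by (rule member_le_sum) (use box in auto)
    moreover have "1/2 * (1 - u $ j) \<le> u $ j * (1 - u $ j)"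
      by (rule mult_right_mono) (use box that in auto)
    ultimately have "1/2 * (1 - u $ j) \<le> 1 / (4 * (real S + 1))" using pen by linarith
    then show ?thesis by (simp add: field_simps)
  qed
  show ?thesis
  proof (cases "i \<in> I")
    case True
    then show ?thesis using I(3) box closest_integer_unit_interval(2)[of "u $ i" "v $ i"] by auto
  next
    case False
    have "u $ i \<le> 1/2"
    proof (rule ccontr)
      assume "\<not> u $ i \<le> 1/2"
      then have big: "1/2 < u $ j" if "j \<in> insert i I" for j
        using that False I(2) by force
      have "real S + 1/2 = (\<Sum>j\<in>insert i I. 1 - 1 / (2 * (real S + 1)))"
        using False I(1) by (simp add: field_simps)
      also have "\<dots> \<le> (\<Sum>j\<in>insert i I. u $ j)"
        by (rule sum_mono) (use big near_one in blast)
      also have "\<dots> \<le> (\<Sum>j\<in>UNIV. u $ j)"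
        by (rule sum_mono2) (use box in auto)
      finally show False using budget by linarith
    qed
    then show ?thesis using False I(4) box by auto
  qed
qed

text \<open>
  Componentwise, with \<open>d = \<bar>u $ i - v $ i\<bar> \<le> 1/2\<close> the penalty term is \<open>d * (1 - d) \<ge> d / 2\<close>.
\<close>

lemma norm_diff_binary_le_penalty:
  fixes u v :: "real^'l"
  assumes bin: "\<forall>i. v $ i \<in> {0, 1}" and box: "\<forall>i. u $ i \<in> {0..1}"
    and half: "\<And>i. \<bar>u $ i - v $ i\<bar> \<le> 1/2"
  shows "norm (u - v) \<le> 2 * (\<Sum>i\<in>UNIV. u $ i * (1 - u $ i))"
proof -
  have "norm (u - v) \<le> (\<Sum>i\<in>UNIV. \<bar>(u - v) $ i\<bar>)" by (rule norm_le_l1_cart)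
  also have "\<dots> \<le> (\<Sum>i\<in>UNIV. 2 * (u $ i * (1 - u $ i)))"
  proof (rule sum_mono)
    fix i
    have u: "0 \<le> u $ i" "u $ i \<le> 1" using box by auto
    consider "v $ i = 0" | "v $ i = 1" using bin by auto
    then show "\<bar>(u - v) $ i\<bar> \<le> 2 * (u $ i * (1 - u $ i))"
    proof cases
      case 1
      then have "u $ i * (1/2) \<le> u $ i * (1 - u $ i)"
        using half[of i] u by (intro mult_left_mono) auto
      then show ?thesis using 1 u by simp
    next
      case 2
      then have "1/2 * (1 - u $ i) \<le> u $ i * (1 - u $ i)"
        using half[of i] u by (intro mult_right_mono) auto
      then show ?thesis using 2 u by simp
    qed
  qed
  finally show ?thesis by (simp add: sum_distrib_left)
qed

section \<open>The feasible sets and the objectives\<close>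

lemma state_map_bounded_linear: "bounded_linear (state_map K M \<Phi>)"
  unfolding state_map_def by (rule matrix_vector_mul_bounded_linear)

lemma W_set_subset_X_set: "W_set K M \<Phi> S \<subseteq> X_set K M \<Phi> S"
proof -
  have "t \<in> {0..1}" if "t \<in> {0, 1}" for t :: real using that by auto
  then show ?thesis unfolding W_set_def X_set_def by blast
qed

lemma closed_W_set: "closed (W_set K M \<Phi> S)"
proof -
  have "W_set K M \<Phi> S = {p. (\<forall>i. snd p $ i = 0 \<or> snd p $ i = 1) \<and>
      (\<Sum>i\<in>UNIV. snd p $ i) \<le> real S \<and> fst p = state_map K M \<Phi> (snd p)}"
    unfolding W_set_def by auto
  also have "closed \<dots>"
    by (intro closed_Collect_conj closed_Collect_all closed_Collect_disj closed_Collect_eq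
        closed_Collect_le continuous_intros bounded_linear.continuous_on[OF state_map_bounded_linear])
  finally show ?thesis .
qed

lemma zero_in_W_set: "0 \<in> W_set K M \<Phi> S"
  unfolding W_set_def zero_prod_def state_map_def by simp

lemma smart_round_point_in_W_set:
  assumes "smart_rounding_map S sr" "p \<in> X_set K M \<Phi> S"
  shows "smart_round_point K M \<Phi> sr p \<in> W_set K M \<Phi> S"
proof -
  have p: "\<forall>i. snd p $ i \<in> {0..1}" "(\<Sum>i\<in>UNIV. snd p $ i) \<le> real S"
    using assms(2) unfolding X_set_def by auto
  then have "is_smart_rounding S (snd p) (sr (snd p))"
    using assms(1) unfolding smart_rounding_map_def by blast
  from smart_rounding_feasible[OF p(1) this] show ?thesis
    unfolding W_set_def smart_round_point_def by auto
qed

lemma J_pen_eq: "J_pen M yd \<epsilon> p = J_tilde M yd p + 1/\<epsilon> * (\<Sum>i\<in>UNIV. snd p $ i * (1 - snd p $ i))"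
  unfolding J_pen_def J_tilde_def ..

lemma J_pen_eq_J_tilde_on_W:
  assumes "p \<in> W_set K M \<Phi> S"
  shows "J_pen M yd \<epsilon> p = J_tilde M yd p"
proof -
  have "snd p $ i * (1 - snd p $ i) = 0" for i using assms unfolding W_set_def by auto
  then have "(\<Sum>i\<in>UNIV. snd p $ i * (1 - snd p $ i)) = 0" by (intro sum.neutral) blast
  then show ?thesis unfolding J_pen_eq by simp
qed

lemma J_tilde_nonneg: "pos_def_mat M \<Longrightarrow> 0 \<le> J_tilde M yd p"
  unfolding J_tilde_def pos_def_mat_def by (cases "fst p - yd = 0") (auto simp: less_imp_le)

lemma continuous_J_pen: "continuous_on UNIV (J_pen M yd \<epsilon>)"
  unfolding J_pen_def
  by (intro continuous_intros
      bounded_linear.continuous_on[OF matrix_vector_mul_bounded_linear])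

text \<open>
  A quadratic form is Lipschitz on bounded sets, since
  \<open>a \<bullet> A a - b \<bullet> A b = (a - b) \<bullet> A a + b \<bullet> A (a - b)\<close>, and the states of points in \<open>X\<close> are
  bounded as images of the unit cube under a linear map.
\<close>

lemma J_tilde_lipschitz_on_X:
  fixes \<Phi> :: "real^'l^'n"
  obtains L where "0 \<le> L"
    and "\<And>p q. p \<in> X_set K M \<Phi> S \<Longrightarrow> q \<in> X_set K M \<Phi> S \<Longrightarrow>
      \<bar>J_tilde M yd p - J_tilde M yd q\<bar> \<le> L * norm (p - q)"
proof -
  obtain B where B: "B > 0" "\<And>u. norm (state_map K M \<Phi> u) \<le> norm u * B"
    using bounded_linear.pos_bounded[OF state_map_bounded_linear, of K M \<Phi>] by blast
  obtain C where C: "C > 0" "\<And>y. norm (M *v y) \<le> norm y * C"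
    using bounded_linear.pos_bounded[OF matrix_vector_mul_bounded_linear, of M] by blast
  define R where "R = real CARD('l) * B + norm yd"
  have R: "norm (fst p - yd) \<le> R" if "p \<in> X_set K M \<Phi> S" for p
  proof -
    have p: "\<forall>i. snd p $ i \<in> {0..1}" "fst p = state_map K M \<Phi> (snd p)"
      using that unfolding X_set_def by auto
    have "norm (snd p) \<le> (\<Sum>i\<in>UNIV. \<bar>snd p $ i\<bar>)" by (rule norm_le_l1_cart)
    also have "\<dots> \<le> (\<Sum>i\<in>(UNIV::'l set). 1)"
      by (rule sum_mono) (use p(1) in auto)
    finally have "norm (snd p) * B \<le> real CARD('l) * B" using B(1) by simp
    then show ?thesis unfolding R_def
      using B(2)[of "snd p"] p(2) norm_triangle_ineq4[of "fst p" yd] by simp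
  qed
  have R0: "0 \<le> R" unfolding R_def using B(1) by simp
  show thesis
  proof (rule that)
    show "0 \<le> R * C" using R0 C(1) by simp
    fix p q assume pq: "p \<in> X_set K M \<Phi> S" "q \<in> X_set K M \<Phi> S"
    define a where "a = fst p - yd"
    define b where "b = fst q - yd"
    have ab: "norm (a - b) \<le> norm (p - q)"
      using norm_fst_le[of "fst (p - q)" "snd (p - q)"] unfolding a_def b_def prod.collapse by simp
    have "a \<bullet> (M *v a) - b \<bullet> (M *v b) = (a - b) \<bullet> (M *v a) + b \<bullet> (M *v (a - b))"
      by (simp add: matrix_vector_mult_diff_distrib inner_diff_left inner_diff_right)
    also have "\<bar>\<dots>\<bar> \<le> \<bar>(a - b) \<bullet> (M *v a)\<bar> + \<bar>b \<bullet> (M *v (a - b))\<bar>" by (rule abs_triangle_ineq)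
    also have "\<dots> \<le> norm (a - b) * norm (M *v a) + norm b * norm (M *v (a - b))"
      by (intro add_mono Cauchy_Schwarz_ineq2)
    also have "\<dots> \<le> norm (a - b) * (R * C) + R * (norm (a - b) * C)"
    proof (intro add_mono mult_mono)
      show "norm (M *v a) \<le> R * C"
        using C(2)[of a] mult_right_mono[OF R[OF pq(1)], of C] C(1) unfolding a_def by linarith
      show "norm b \<le> R" unfolding b_def by (rule R[OF pq(2)])
    qed (use C R0 in auto)
    also have "\<dots> = 2 * (R * C * norm (a - b))" by simp
    also have "\<dots> \<le> 2 * (R * C * norm (p - q))"
      using ab R0 C(1) by (simp add: mult_left_mono)
    finally show "\<bar>J_tilde M yd p - J_tilde M yd q\<bar> \<le> R * C * norm (p - q)"
      unfolding J_tilde_def a_def[symmetric] b_def[symmetric] by simp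
  qed
qed

section \<open>Exactness of the penalty\<close>

text \<open>The origin lies in \<open>W\<close>, where the penalty vanishes, and serves as the competitor.\<close>

lemma penalty_le_of_approx_min:
  fixes \<Phi> :: "real^'l^'n"
  assumes "pos_def_mat M" "0 < \<epsilon>"
    and "\<And>z. z \<in> X_set K M \<Phi> S \<Longrightarrow> J_pen M yd \<epsilon> p \<le> J_pen M yd \<epsilon> z + \<delta>"
  shows "(\<Sum>i\<in>UNIV. snd p $ i * (1 - snd p $ i)) \<le> \<epsilon> * (J_tilde M yd (0 :: (real^'n) \<times> (real^'l)) + \<delta>)"
    (is "?P \<le> _")
proof -
  have "J_pen M yd \<epsilon> p \<le> J_tilde M yd (0 :: (real^'n) \<times> (real^'l)) + \<delta>"
    using assms(3)[OF subsetD[OF W_set_subset_X_set zero_in_W_set]]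
    unfolding J_pen_eq_J_tilde_on_W[OF zero_in_W_set[of K M \<Phi> S]] .
  then have "1/\<epsilon> * ?P \<le> J_tilde M yd (0 :: (real^'n) \<times> (real^'l)) + \<delta>"
    using J_tilde_nonneg[OF assms(1), of yd p] unfolding J_pen_eq by linarith
  then show ?thesis using assms(2) by (simp add: field_simps)
qed

text \<open>
  Both sides are compared with the distance \<open>norm (u - v)\<close> of the controls: the point itself moves by
  at most \<open>(B + 1)\<close> times this distance, because the state depends linearly on the control, while
  the penalty drops by at least \<open>1/2\<close> times it.
\<close>

lemma rounding_gain_gt:
  fixes \<Phi> :: "real^'l^'n"
  assumes sr: "smart_rounding_map S sr"
  obtains c where "0 < c"
    and "\<And>\<epsilon> p. 0 < \<epsilon> \<Longrightarrow> \<epsilon> < c \<Longrightarrow> p \<in> X_set K M \<Phi> S \<Longrightarrow> p \<notin> W_set K M \<Phi> S \<Longrightarrow>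
      (\<Sum>i\<in>UNIV. snd p $ i * (1 - snd p $ i)) \<le> 1 / (4 * (real S + 1)) \<Longrightarrow>
      \<epsilon> * norm (p - smart_round_point K M \<Phi> sr p)
        < J_pen M yd \<epsilon> p - J_pen M yd \<epsilon> (smart_round_point K M \<Phi> sr p)"
proof -
  obtain B where B: "B > 0" "\<And>u. norm (state_map K M \<Phi> u) \<le> norm u * B"
    using bounded_linear.pos_bounded[OF state_map_bounded_linear, of K M \<Phi>] by blast
  obtain L where L: "0 \<le> L" "\<And>p q. p \<in> X_set K M \<Phi> S \<Longrightarrow> q \<in> X_set K M \<Phi> S \<Longrightarrow>
      \<bar>J_tilde M yd p - J_tilde M yd q\<bar> \<le> L * norm (p - q)"
    using J_tilde_lipschitz_on_X[of K M \<Phi> S yd] by blast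
  \<comment> \<open>The bound \<open>1\<close> turns the requirement \<open>2 * \<epsilon> * (L + \<epsilon>) * (B + 1) < 1\<close> into a linear one.\<close>
  define c where "c = min 1 (1 / (2 * (L + 1) * (B + 1)))"
  show thesis
  proof (rule that)
    show "0 < c" unfolding c_def using B(1) L(1) by simp
    fix \<epsilon> p
    assume e: "0 < \<epsilon>" "\<epsilon> < c" and pX: "p \<in> X_set K M \<Phi> S" and pW: "p \<notin> W_set K M \<Phi> S"
      and pen: "(\<Sum>i\<in>UNIV. snd p $ i * (1 - snd p $ i)) \<le> 1 / (4 * (real S + 1))"
    define q where "q = smart_round_point K M \<Phi> sr p"
    define P where "P = (\<Sum>i\<in>UNIV. snd p $ i * (1 - snd p $ i))"
    have qW: "q \<in> W_set K M \<Phi> S" unfolding q_def by (rule smart_round_point_in_W_set[OF sr pX])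
    then have qX: "q \<in> X_set K M \<Phi> S" using W_set_subset_X_set by blast
    have p: "\<forall>i. snd p $ i \<in> {0..1}" "(\<Sum>i\<in>UNIV. snd p $ i) \<le> real S"
        "fst p = state_map K M \<Phi> (snd p)"
      using pX unfolding X_set_def by auto
    have q: "\<forall>i. snd q $ i \<in> {0, 1}" "fst q = state_map K M \<Phi> (snd q)"
      using qW unfolding W_set_def by auto
    have round: "is_smart_rounding S (snd p) (snd q)"
      using sr p unfolding smart_rounding_map_def q_def smart_round_point_def by simp
    have D: "norm (snd p - snd q) \<le> 2 * P" unfolding P_def
      by (rule norm_diff_binary_le_penalty[OF q(1) p(1)
            smart_rounding_error_le_half[OF p(1,2) round pen]])
    have "norm (fst p - fst q) \<le> norm (snd p - snd q) * B"
      using B(2)[of "snd p - snd q"] p(3) q(2)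
      by (simp add: linear_diff[OF bounded_linear.linear[OF state_map_bounded_linear]])
    then have "norm (p - q) \<le> norm (snd p - snd q) * (B + 1)"
      using norm_Pair_le[of "fst (p - q)" "snd (p - q)"] unfolding prod.collapse
      by (simp add: algebra_simps)
    also have "\<dots> \<le> 2 * P * (B + 1)" using D B(1) by (intro mult_right_mono) auto
    finally have move: "norm (p - q) \<le> 2 * P * (B + 1)" .
    have "0 < norm (p - q)" using pW qW by auto
    then have "0 < 2 * P * (B + 1)" using move by linarith
    then have P0: "0 < P" using B(1) by (simp add: zero_less_mult_iff)
    have "(L + \<epsilon>) * norm (p - q) \<le> (L + 1) * (2 * P * (B + 1))"
      using move e L(1) unfolding c_def by (intro mult_mono) auto
    also have "\<dots> = (2 * (L + 1) * (B + 1)) * P" by (simp add: algebra_simps)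
    also have "\<dots> < 1/\<epsilon> * P"
    proof (rule mult_strict_right_mono[OF _ P0])
      have "\<epsilon> < 1 / (2 * (L + 1) * (B + 1))" using e(2) unfolding c_def by simp
      moreover have "0 < 2 * (L + 1) * (B + 1)" using L(1) B(1) by simp
      ultimately show "2 * (L + 1) * (B + 1) < 1/\<epsilon>" using e(1) by (simp only: field_simps)
    qed
    finally have "(L + \<epsilon>) * norm (p - q) < 1/\<epsilon> * P" .
    moreover have "J_pen M yd \<epsilon> p - J_pen M yd \<epsilon> q = J_tilde M yd p - J_tilde M yd q + 1/\<epsilon> * P"
      using J_pen_eq_J_tilde_on_W[OF qW] unfolding J_pen_eq[of M yd \<epsilon> p] P_def by simp
    ultimately show "\<epsilon> * norm (p - smart_round_point K M \<Phi> sr p)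
        < J_pen M yd \<epsilon> p - J_pen M yd \<epsilon> (smart_round_point K M \<Phi> sr p)"
      using L(2)[OF pX qX] unfolding q_def[symmetric] by (simp add: algebra_simps)
  qed
qed

section \<open>The parameter sequences\<close>

text \<open>Infinitely many contractions by \<open>\<sigma>\<close> would push \<open>\<epsilon>\<close> below the threshold \<open>c\<close> for good.\<close>

lemma nonincreasing_eventually_not_contracted:
  fixes \<epsilon> :: "nat \<Rightarrow> real"
  assumes "0 < \<sigma>" "\<sigma> < 1" "0 < c"
    and step: "\<And>n. \<epsilon> (Suc n) = (if T n then \<sigma> * \<epsilon> n else \<epsilon> n)"
    and pos: "\<And>n. 0 < \<epsilon> n"
    and threshold: "\<And>n. T n \<Longrightarrow> c \<le> \<epsilon> n"
  obtains m where "\<And>n. m \<le> n \<Longrightarrow> \<not> T n"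
proof -
  have "decseq \<epsilon>"
    unfolding decseq_Suc_iff
    using step pos assms(2) by (simp add: mult_left_le_one_le less_imp_le assms(1))
  then have mono: "\<epsilon> n \<le> \<epsilon> m" if "m \<le> n" for m n using that by (rule decseqD)
  have "\<exists>m. \<forall>n\<ge>m. \<not> T n"
  proof (rule ccontr)
    assume "\<not> (\<exists>m. \<forall>n\<ge>m. \<not> T n)"
    then have often: "\<exists>n\<ge>m. T n" for m by blast
    have small: "\<exists>n. \<epsilon> n \<le> \<sigma> ^ k * \<epsilon> 0" for k
    proof (induction k)
      case (Suc k)
      then obtain m where m: "\<epsilon> m \<le> \<sigma> ^ k * \<epsilon> 0" by blast
      obtain n where n: "m \<le> n" "T n" using often by blast
      have "\<epsilon> (Suc n) = \<sigma> * \<epsilon> n" using step n(2) by simp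
      also have "\<dots> \<le> \<sigma> * (\<sigma> ^ k * \<epsilon> 0)"
        using mono[OF n(1)] m assms(1) by (intro mult_left_mono) auto
      finally show ?case by (auto simp: mult.assoc)
    qed auto
    obtain k where k: "\<sigma> ^ k < c / \<epsilon> 0"
      using real_arch_pow_inv[of "c / \<epsilon> 0" \<sigma>] assms(2,3) pos[of 0] by auto
    obtain m where "\<epsilon> m \<le> \<sigma> ^ k * \<epsilon> 0" using small by blast
    moreover have "\<sigma> ^ k * \<epsilon> 0 < c" using k pos[of 0] by (simp add: field_simps)
    moreover obtain n where "m \<le> n" "T n" using often by blast
    ultimately show False using mono[of m n] threshold[of n] by linarith
  qed
  then show thesis using that by blast
qed

text \<open>
  This isolates what the parameter update achieves: from some index on, \<open>\<epsilon>\<close> is a constant \<open>e\<close>, the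
  reduction test fails, and the tolerances vanish.
\<close>

lemma EXP_sequence_eventually:
  fixes \<Phi> :: "real^'l^'n" and x :: "nat \<Rightarrow> (real^'n) \<times> (real^'l)"
  assumes M: "pos_def_mat M" and sr: "smart_rounding_map S sr"
    and pos0: "\<epsilon>0 > 0" "\<delta>0 > 0" and sig: "0 < \<sigma>" "\<sigma> < 1"
    and run: "EXP_sequence K M \<Phi> yd S sr \<epsilon>0 \<delta>0 \<sigma> x"
  shows "\<exists>e>0. \<exists>m \<delta>. \<delta> \<longlonglongrightarrow> 0 \<and> (\<forall>n. x n \<in> X_set K M \<Phi> S) \<and>
    (\<forall>n\<ge>m. \<forall>z\<in>X_set K M \<Phi> S. J_pen M yd e (x n) \<le> J_pen M yd e z + \<delta> n) \<and>
    (\<forall>n\<ge>m. x n \<notin> W_set K M \<Phi> S \<longrightarrow>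
      e * norm (x n - smart_round_point K M \<Phi> sr (x n))
        < J_pen M yd e (x n) - J_pen M yd e (smart_round_point K M \<Phi> sr (x n)))"
proof -
  obtain \<epsilon> \<delta> :: "nat \<Rightarrow> real" where init: "\<epsilon> 0 = \<epsilon>0" "\<delta> 0 = \<delta>0"
    and xX: "\<And>n. x n \<in> X_set K M \<Phi> S"
    and amin: "\<And>n z. z \<in> X_set K M \<Phi> S \<Longrightarrow> J_pen M yd (\<epsilon> n) (x n) \<le> J_pen M yd (\<epsilon> n) z + \<delta> n"
    and upd: "\<And>n. if x n \<notin> W_set K M \<Phi> S \<and>
            J_pen M yd (\<epsilon> n) (x n) - J_pen M yd (\<epsilon> n) (smart_round_point K M \<Phi> sr (x n))
              \<le> \<epsilon> n * norm (x n - smart_round_point K M \<Phi> sr (x n))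
         then \<epsilon> (Suc n) = \<sigma> * \<epsilon> n \<and> \<delta> (Suc n) = \<delta> n
         else \<epsilon> (Suc n) = \<epsilon> n \<and> \<delta> (Suc n) = \<sigma> * \<delta> n"
    using run unfolding EXP_sequence_def by blast
  define T where "T n \<longleftrightarrow> x n \<notin> W_set K M \<Phi> S \<and>
      J_pen M yd (\<epsilon> n) (x n) - J_pen M yd (\<epsilon> n) (smart_round_point K M \<Phi> sr (x n))
        \<le> \<epsilon> n * norm (x n - smart_round_point K M \<Phi> sr (x n))" for n
  have estep: "\<epsilon> (Suc n) = (if T n then \<sigma> * \<epsilon> n else \<epsilon> n)"
    and dstep: "\<delta> (Suc n) = (if T n then \<delta> n else \<sigma> * \<delta> n)" for n
    using upd[of n] unfolding T_def by (auto split: if_splits)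
  have epos: "0 < \<epsilon> n" for n
    by (induction n) (use init pos0 sig estep in auto)
  have dpos: "0 < \<delta> n" for n
    by (induction n) (use init pos0 sig dstep in auto)
  have "\<delta> (Suc n) \<le> \<delta> n" for n
    using dstep[of n] dpos[of n] sig by (auto simp: mult_left_le_one_le)
  then have "\<delta> n \<le> \<delta> 0" for n
    by (intro decseqD[of \<delta> 0 n]) (auto simp: decseq_Suc_iff)
  then have dle: "\<delta> n \<le> \<delta>0" for n using init by simp
  define Q where "Q = J_tilde M yd (0 :: (real^'n) \<times> (real^'l)) + \<delta>0"
  have Q: "0 < Q" unfolding Q_def using J_tilde_nonneg[OF M, of yd "0 :: (real^'n) \<times> (real^'l)"] pos0(2) by linarith
  obtain c where c: "0 < c" and gain: "\<And>\<epsilon> p. 0 < \<epsilon> \<Longrightarrow> \<epsilon> < c \<Longrightarrow> p \<in> X_set K M \<Phi> S \<Longrightarrow>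
      p \<notin> W_set K M \<Phi> S \<Longrightarrow>
      (\<Sum>i\<in>UNIV. snd p $ i * (1 - snd p $ i)) \<le> 1 / (4 * (real S + 1)) \<Longrightarrow>
      \<epsilon> * norm (p - smart_round_point K M \<Phi> sr p)
        < J_pen M yd \<epsilon> p - J_pen M yd \<epsilon> (smart_round_point K M \<Phi> sr p)"
    using rounding_gain_gt[OF sr, of K M \<Phi> yd] by blast
  \<comment> \<open>Below the second term of the minimum, the penalty of an iterate is at most
    \<open>\<epsilon> * Q \<le> 1 / (4 * (S + 1))\<close>.\<close>
  define c' where "c' = min c (1 / (4 * (real S + 1) * Q))"
  have c': "0 < c'" unfolding c'_def using c Q by simp
  have threshold: "c' \<le> \<epsilon> n" if "T n" for n
  proof (rule ccontr)
    assume "\<not> c' \<le> \<epsilon> n"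
    then have small: "\<epsilon> n < c" "\<epsilon> n \<le> 1 / (4 * (real S + 1) * Q)" unfolding c'_def by auto
    have "(\<Sum>i\<in>UNIV. snd (x n) $ i * (1 - snd (x n) $ i))
        \<le> \<epsilon> n * (J_tilde M yd (0 :: (real^'n) \<times> (real^'l)) + \<delta> n)"
      by (rule penalty_le_of_approx_min[OF M epos amin])
    also have "\<dots> \<le> \<epsilon> n * Q"
      unfolding Q_def using dle[of n] epos[of n] by (intro mult_left_mono) auto
    also have "\<dots> \<le> 1 / (4 * (real S + 1) * Q) * Q"
      using small(2) Q by (intro mult_right_mono) auto
    also have "\<dots> = 1 / (4 * (real S + 1))" using Q by simp
    finally have "(\<Sum>i\<in>UNIV. snd (x n) $ i * (1 - snd (x n) $ i)) \<le> 1 / (4 * (real S + 1))" .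
    from gain[OF epos small(1) xX _ this] show False using that unfolding T_def by auto
  qed
  obtain m where m: "\<And>n. m \<le> n \<Longrightarrow> \<not> T n"
    using nonincreasing_eventually_not_contracted[where \<epsilon> = \<epsilon> and T = T, OF sig c' estep epos threshold]
    by blast
  have econst: "\<epsilon> n = \<epsilon> m" if "m \<le> n" for n
    using that by (induction n rule: dec_induct) (use m estep in auto)
  have dgeom: "\<delta> (n + m) = \<sigma> ^ n * \<delta> m" for n
    by (induction n) (use m dstep in auto)
  have "(\<lambda>n. \<sigma> ^ n * \<delta> m) \<longlonglongrightarrow> 0 * \<delta> m"
    by (intro tendsto_mult LIMSEQ_power_zero tendsto_const) (use sig in auto)
  then have "(\<lambda>n. \<delta> (n + m)) \<longlonglongrightarrow> 0" by (simp add: dgeom)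
  then have "\<delta> \<longlonglongrightarrow> 0" by (rule LIMSEQ_offset)
  moreover have "\<forall>n\<ge>m. \<forall>z\<in>X_set K M \<Phi> S. J_pen M yd (\<epsilon> m) (x n) \<le> J_pen M yd (\<epsilon> m) z + \<delta> n"
    using amin econst by metis
  moreover have "\<forall>n\<ge>m. x n \<notin> W_set K M \<Phi> S \<longrightarrow>
      \<epsilon> m * norm (x n - smart_round_point K M \<Phi> sr (x n))
        < J_pen M yd (\<epsilon> m) (x n) - J_pen M yd (\<epsilon> m) (smart_round_point K M \<Phi> sr (x n))"
    using m econst unfolding T_def by (metis not_le)
  ultimately show ?thesis using epos[of m] xX by blast
qed

section \<open>Accumulation points\<close>

theorem proposition3p6:
  fixes M K :: "real^'n^'n" and \<Phi> :: "real^'l^'n" and yd :: "real^'n" and S :: nat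
    and sr :: "real^'l \<Rightarrow> real^'l" and \<epsilon>0 \<delta>0 \<sigma> :: real
    and x :: "nat \<Rightarrow> (real^'n) \<times> (real^'l)" and xstar :: "(real^'n) \<times> (real^'l)"
  assumes "S \<le> CARD('l)"
    and "transpose M = M" and "pos_def_mat M"
    and "pos_def_mat K"
    and "smart_rounding_map S sr"
    and "\<epsilon>0 > 0" and "\<delta>0 > 0" and "0 < \<sigma>" and "\<sigma> < 1"
    and "EXP_sequence K M \<Phi> yd S sr \<epsilon>0 \<delta>0 \<sigma> x"
    and "accumulation_point x xstar"
  shows "is_arg_min (J_tilde M yd) (\<lambda>z. z \<in> W_set K M \<Phi> S) xstar"
proof -
  obtain e m and \<delta> :: "nat \<Rightarrow> real" where e: "0 < e" and \<delta>: "\<delta> \<longlonglongrightarrow> 0"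
    and xX: "\<forall>n. x n \<in> X_set K M \<Phi> S"
    and amin: "\<forall>n\<ge>m. \<forall>z\<in>X_set K M \<Phi> S. J_pen M yd e (x n) \<le> J_pen M yd e z + \<delta> n"
    and gain: "\<forall>n\<ge>m. x n \<notin> W_set K M \<Phi> S \<longrightarrow>
      e * norm (x n - smart_round_point K M \<Phi> sr (x n))
        < J_pen M yd e (x n) - J_pen M yd e (smart_round_point K M \<Phi> sr (x n))"
    using EXP_sequence_eventually[OF assms(3,5-10)] by blast
  obtain r where r: "strict_mono r" "(x \<circ> r) \<longlonglongrightarrow> xstar"
    using assms(11) unfolding accumulation_point_def by blast
  have late: "eventually (\<lambda>k. m \<le> r k) sequentially"
    using filterlim_subseq[OF r(1)] by (simp add: filterlim_at_top)
  have \<delta>r: "(\<delta> \<circ> r) \<longlonglongrightarrow> 0" by (rule LIMSEQ_subseq_LIMSEQ[OF \<delta> r(1)])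

  define w where "w n = (if x n \<in> W_set K M \<Phi> S then x n else smart_round_point K M \<Phi> sr (x n))"
    for n
  have wW: "w n \<in> W_set K M \<Phi> S" for n
    unfolding w_def using smart_round_point_in_W_set[OF assms(5) spec[OF xX]] by auto
  have near: "norm (w n - x n) \<le> \<delta> n / e" if "m \<le> n" for n
  proof -
    have "w n \<in> X_set K M \<Phi> S" using wW W_set_subset_X_set by blast
    then have le: "J_pen M yd e (x n) \<le> J_pen M yd e (w n) + \<delta> n" using amin that by blast
    have "e * norm (x n - w n) \<le> J_pen M yd e (x n) - J_pen M yd e (w n)"
      using gain that unfolding w_def by (auto intro: less_imp_le)
    then have "e * norm (x n - w n) \<le> \<delta> n" using le by linarith
    then show ?thesis using e by (simp add: field_simps norm_minus_commute)
  qed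
  have "(\<lambda>k. w (r k) - x (r k)) \<longlonglongrightarrow> 0"
  proof (rule Lim_null_comparison)
    show "eventually (\<lambda>k. norm (w (r k) - x (r k)) \<le> \<delta> (r k) / e) sequentially"
      using late by eventually_elim (rule near)
    show "(\<lambda>k. \<delta> (r k) / e) \<longlonglongrightarrow> 0"
      using tendsto_divide[OF \<delta>r tendsto_const[of e]] e by (simp add: o_def)
  qed
  from tendsto_add[OF this r(2)] have "(\<lambda>k. w (r k)) \<longlonglongrightarrow> xstar" by (simp add: o_def)
  then have star: "xstar \<in> W_set K M \<Phi> S"
    by (rule Lim_in_closed_set[OF closed_W_set always_eventually[OF allI[OF wW]]
          trivial_limit_sequentially])

  have "J_tilde M yd xstar \<le> J_tilde M yd z" if z: "z \<in> W_set K M \<Phi> S" for z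
  proof -
    have "z \<in> X_set K M \<Phi> S" using z W_set_subset_X_set by blast
    then have le: "eventually (\<lambda>k. J_pen M yd e (x (r k)) \<le> J_pen M yd e z + \<delta> (r k)) sequentially"
      using late amin by (auto elim: eventually_mono)
    have lim1: "(\<lambda>k. J_pen M yd e (x (r k))) \<longlonglongrightarrow> J_pen M yd e xstar"
      using continuous_on_tendsto_compose[OF continuous_J_pen r(2)] by (simp add: o_def)
    have lim2: "(\<lambda>k. J_pen M yd e z + \<delta> (r k)) \<longlonglongrightarrow> J_pen M yd e z"
      using tendsto_add[OF tendsto_const[of "J_pen M yd e z"] \<delta>r] by (simp add: o_def)
    have "J_pen M yd e xstar \<le> J_pen M yd e z"
      by (rule tendsto_le[OF trivial_limit_sequentially lim2 lim1 le])
    then show ?thesis using J_pen_eq_J_tilde_on_W[OF star] J_pen_eq_J_tilde_on_W[OF z] by simp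
  qed
  then show ?thesis unfolding is_arg_min_linorder using star by blast
qed

end
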